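(* Let $\boldsymbol t\in\mathbb{R}^{nm}$ with $t_l\ge0$ for all $0\le l<nm$. For each $p=un+v$ with $0\le u<m$, $0\le v<n$, let $$I_p=\{i:\ 0\le i<nm,\ \lfloor i/n\rfloor=u\ \text{ or }\ i\bmod n=v\},\qquad I_p^C=\{i:\ 0\le i<nm,\ i\notin I_p\},$$ and $$\mathcal R^{Re}_p=\left\{\boldsymbol\theta\in\mathbb{R}^{m+n}:\ \sum_{l\in I_p}(\boldsymbol x_l^T\boldsymbol\theta-\lambda c_l)t_l\le0,\ \ \sum_{l\in I_p^C}(\boldsymbol x_l^T\boldsymbol\theta-\lambda c_l)t_l\le0\right\}.$$ Then for every $p$, $\mathcal R^{Re}_p$ is a safe region for the unbalanced optimal transport (UOT) problem, i.e. it contains the optimal dual solution: $\hat{\boldsymbol\theta}\in\mathcal R^{Re}_p$.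
   Context: Let $m,n\ge1$, $\lambda>0$, a cost vector $\boldsymbol c\in\mathbb{R}^{nm}_+$ and $\boldsymbol y\in\mathbb{R}^{m+n}$ be given. All indices start at $0$. A transport matrix $\mathbf T\in\mathbb{R}^{m\times n}_+$ is flattened row by row into $\boldsymbol t\in\mathbb{R}^{nm}_+$ ($t_{un+v}=T_{u,v}$), and the cost matrix into $\boldsymbol c$ likewise. The index matrix $\mathbf X\in\{0,1\}^{(m+n)\times nm}$ is such that $\mathbf X\boldsymbol t$ lists the $m$ row sums followed by the $n$ column sums of $\mathbf T$; its $p$-th column $\boldsymbol x_p$, $p=un+v$, has exactly two entries equal to $1$, at positions $u$ and $m+v$. The UOT problem is $\min_{\boldsymbol t\in\mathbb{R}^{nm}_+}\lambda\boldsymbol c^T\boldsymbol t+D_\phi(\mathbf X\boldsymbol t,\boldsymbol y)$, where $D_\phi(\cdot,\boldsymbol y)$ is a proper convex penalty (a divergence in its first argument) with convex conjugate $D_\phi^*$. Its optimal dual solution $\hat{\boldsymbol\theta}$ is a maximizer of $-D_\phi^*(-\boldsymbol\theta)$ over the dual feasible region $\mathcal R^D=\{\boldsymbol\theta\in\mathbb{R}^{m+n}:\boldsymbol x_l^T\boldsymbol\theta-\lambda c_l\le0\ \text{for all } 0\le l<nm\}$. *)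

theory Defs
  imports "HOL-Library.Extended_Real" "Jordan_Normal_Form.Matrix"
begin

text \<open>
  Vectors of length \<open>N\<close> are elements of \<open>carrier_vec N\<close>, with indices starting at \<open>0\<close>.  An
  \<open>m \<times> n\<close> transport or cost matrix is flattened row by row: its entry \<open>(u, v)\<close> is stored at
  index \<open>u * n + v\<close>.
\<close>

definition index_matrix :: "nat \<Rightarrow> nat \<Rightarrow> real mat" where
  "index_matrix m n = mat (m + n) (n * m) (\<lambda>(i, p). if i = p div n \<or> i = m + p mod n then 1 else 0)"

text \<open>
  Penalties take values in the extended reals, \<open>\<infinity>\<close> encoding points outside the effective domain.
\<close>

definition proper_convex :: "nat \<Rightarrow> (real vec \<Rightarrow> ereal) \<Rightarrow> bool" where
  "proper_convex N f \<longleftrightarrow>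
     (\<forall>z \<in> carrier_vec N. f z \<noteq> -\<infinity>) \<and>
     (\<exists>z \<in> carrier_vec N. f z \<noteq> \<infinity>) \<and>
     (\<forall>z \<in> carrier_vec N. \<forall>w \<in> carrier_vec N. \<forall>a. 0 < a \<and> a < 1 \<longrightarrow>
        f ((1 - a) \<cdot>\<^sub>v z + a \<cdot>\<^sub>v w) \<le> ereal (1 - a) * f z + ereal a * f w)"

definition convex_conjugate :: "nat \<Rightarrow> (real vec \<Rightarrow> ereal) \<Rightarrow> real vec \<Rightarrow> ereal" where
  "convex_conjugate N f \<theta> = (SUP z \<in> carrier_vec N. ereal (\<theta> \<bullet> z) - f z)"

definition uot_primal_objective ::
    "nat \<Rightarrow> nat \<Rightarrow> real \<Rightarrow> real vec \<Rightarrow> (real vec \<Rightarrow> real vec \<Rightarrow> ereal) \<Rightarrow> real vec \<Rightarrow> real vec \<Rightarrow> ereal" where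
  "uot_primal_objective m n lam c D y t = ereal (lam * (c \<bullet> t)) + D (index_matrix m n *\<^sub>v t) y"

definition uot_dual_objective ::
    "nat \<Rightarrow> nat \<Rightarrow> (real vec \<Rightarrow> real vec \<Rightarrow> ereal) \<Rightarrow> real vec \<Rightarrow> real vec \<Rightarrow> ereal" where
  "uot_dual_objective m n D y \<theta> = - convex_conjugate (m + n) (\<lambda>z. D z y) (- \<theta>)"

definition uot_dual_feasible :: "nat \<Rightarrow> nat \<Rightarrow> real \<Rightarrow> real vec \<Rightarrow> real vec set" where
  "uot_dual_feasible m n lam c =
     {\<theta> \<in> carrier_vec (m + n). \<forall>l < n * m. col (index_matrix m n) l \<bullet> \<theta> - lam * c $ l \<le> 0}"

definition uot_dual_optimal ::
    "nat \<Rightarrow> nat \<Rightarrow> real \<Rightarrow> real vec \<Rightarrow> (real vec \<Rightarrow> real vec \<Rightarrow> ereal) \<Rightarrow> real vec \<Rightarrow> real vec \<Rightarrow> bool" where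
  "uot_dual_optimal m n lam c D y \<theta> \<longleftrightarrow>
     \<theta> \<in> uot_dual_feasible m n lam c \<and>
     (\<forall>\<theta>' \<in> uot_dual_feasible m n lam c. uot_dual_objective m n D y \<theta>' \<le> uot_dual_objective m n D y \<theta>)"

text \<open>
  No strict convexity is required, so the dual may have several optimal solutions; a safe region
  has to contain all of them.
\<close>

definition uot_safe_region ::
    "nat \<Rightarrow> nat \<Rightarrow> real \<Rightarrow> real vec \<Rightarrow> (real vec \<Rightarrow> real vec \<Rightarrow> ereal) \<Rightarrow> real vec \<Rightarrow> real vec set \<Rightarrow> bool" where
  "uot_safe_region m n lam c D y R \<longleftrightarrow> (\<forall>\<theta>. uot_dual_optimal m n lam c D y \<theta> \<longrightarrow> \<theta> \<in> R)"

text \<open>The index \<open>p = u * n + v\<close> enters only through its row \<open>u\<close> and its column \<open>v\<close>.\<close>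

definition cross_indices :: "nat \<Rightarrow> nat \<Rightarrow> nat \<Rightarrow> nat \<Rightarrow> nat set" where
  "cross_indices m n u v = {i. i < n * m \<and> (i div n = u \<or> i mod n = v)}"

definition cross_indices_compl :: "nat \<Rightarrow> nat \<Rightarrow> nat \<Rightarrow> nat \<Rightarrow> nat set" where
  "cross_indices_compl m n u v = {i. i < n * m \<and> i \<notin> cross_indices m n u v}"

definition relaxed_region ::
    "nat \<Rightarrow> nat \<Rightarrow> real \<Rightarrow> real vec \<Rightarrow> real vec \<Rightarrow> nat \<Rightarrow> nat \<Rightarrow> real vec set" where
  "relaxed_region m n lam c t u v =
     {\<theta> \<in> carrier_vec (m + n).
        (\<Sum>l \<in> cross_indices m n u v. (col (index_matrix m n) l \<bullet> \<theta> - lam * c $ l) * t $ l) \<le> 0 \<and>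
        (\<Sum>l \<in> cross_indices_compl m n u v. (col (index_matrix m n) l \<bullet> \<theta> - lam * c $ l) * t $ l) \<le> 0}"

text \<open>Weak duality: the dual objective on the dual feasible region bounds the UOT problem from below.\<close>

lemma uot_weak_duality:
  assumes c: "c \<in> carrier_vec (n * m)"
    and t: "t \<in> carrier_vec (n * m)" and t0: "\<And>l. l < n * m \<Longrightarrow> 0 \<le> t $ l"
    and \<theta>: "\<theta> \<in> uot_dual_feasible m n lam c"
  shows "uot_dual_objective m n D y \<theta> \<le> uot_primal_objective m n lam c D y t"
proof -
  let ?X = "index_matrix m n"
  let ?z = "?X *\<^sub>v t"
  have X: "?X \<in> carrier_mat (m + n) (n * m)" by (simp add: index_matrix_def)
  have z: "?z \<in> carrier_vec (m + n)" using mult_mat_vec_carrier[OF X t] .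
  have \<theta>c: "\<theta> \<in> carrier_vec (m + n)" using \<theta> by (simp add: uot_dual_feasible_def)
  have "\<theta> \<bullet> ?z = (transpose_mat ?X *\<^sub>v \<theta>) \<bullet> t"
    using transpose_vec_mult_scalar[OF X t \<theta>c] by simp
  also have "\<dots> = (\<Sum>l = 0..<n * m. (col ?X l \<bullet> \<theta>) * t $ l)"
    using X t by (auto simp: scalar_prod_def intro!: sum.cong)
  also have "\<dots> \<le> (\<Sum>l = 0..<n * m. (lam * c $ l) * t $ l)"
    using \<theta> t0 by (intro sum_mono mult_right_mono) (auto simp: uot_dual_feasible_def)
  also have "\<dots> = lam * (c \<bullet> t)"
    using t by (simp add: scalar_prod_def sum_distrib_left mult.assoc)
  finally have le: "\<theta> \<bullet> ?z \<le> lam * (c \<bullet> t)" .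
  have "ereal (- \<theta> \<bullet> ?z) - D ?z y \<le> convex_conjugate (m + n) (\<lambda>z. D z y) (- \<theta>)"
    unfolding convex_conjugate_def using z by (intro SUP_upper)
  then have "uot_dual_objective m n D y \<theta> \<le> - (ereal (- \<theta> \<bullet> ?z) - D ?z y)"
    by (simp add: uot_dual_objective_def)
  also have "\<dots> = ereal (\<theta> \<bullet> ?z) + D ?z y"
  proof -
    have "- \<theta> \<bullet> ?z = - (\<theta> \<bullet> ?z)"
      using z \<theta>c by (intro scalar_prod_uminus_left) (simp only: carrier_vecD)
    then show ?thesis by (cases "D ?z y") auto
  qed
  also have "\<dots> \<le> ereal (lam * (c \<bullet> t)) + D ?z y"
    using le by (intro add_right_mono) simp
  finally show ?thesis by (simp add: uot_primal_objective_def)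
qed

end

theory Submission
  imports Defs
begin

text \<open>
  A dual feasible \<open>\<theta>\<close> satisfies one inequality for each entry of the transport matrix.
  Weighting these by the nonnegative numbers \<open>t $ l\<close> and adding them up over any set of
  entries gives an inequality that \<open>\<theta>\<close> still satisfies.  The relaxed region imposes two such
  aggregated inequalities, one over the cross formed by row \<open>u\<close> and column \<open>v\<close> and one over
  its complement, so it contains the whole dual feasible region and with it every dual optimum.
\<close>

text \<open>Each summand is a nonpositive dual slack times a nonnegative weight.\<close>

lemma uot_dual_feasible_weighted_sum_nonpos:
  assumes "\<theta> \<in> uot_dual_feasible m n lam c"
    and "\<forall>l < n * m. 0 \<le> t $ l"
    and "S \<subseteq> {..<n * m}"
  shows "(\<Sum>l \<in> S. (col (index_matrix m n) l \<bullet> \<theta> - lam * c $ l) * t $ l) \<le> 0"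
  using assms by (intro sum_nonpos mult_nonpos_nonneg) (auto simp: uot_dual_feasible_def)

lemma uot_dual_feasible_subset_relaxed_region:
  assumes "\<forall>l < n * m. 0 \<le> t $ l"
  shows "uot_dual_feasible m n lam c \<subseteq> relaxed_region m n lam c t u v"
proof
  fix \<theta> assume \<theta>: "\<theta> \<in> uot_dual_feasible m n lam c"
  have "cross_indices m n u v \<subseteq> {..<n * m}" "cross_indices_compl m n u v \<subseteq> {..<n * m}"
    by (auto simp: cross_indices_def cross_indices_compl_def)
  then show "\<theta> \<in> relaxed_region m n lam c t u v"
    using \<theta> uot_dual_feasible_weighted_sum_nonpos[OF \<theta> assms]
    by (simp add: relaxed_region_def uot_dual_feasible_def)
qed

theorem theorem11:
  fixes m n :: nat
    and lam :: real
    and c y t :: "real vec"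
    and D :: "real vec \<Rightarrow> real vec \<Rightarrow> ereal"
  assumes "m \<ge> 1" and "n \<ge> 1"
    and "lam > 0"
    and "c \<in> carrier_vec (n * m)" and "\<forall>l < n * m. 0 \<le> c $ l"
    and "y \<in> carrier_vec (m + n)"
    and "proper_convex (m + n) (\<lambda>z. D z y)"
    and "t \<in> carrier_vec (n * m)" and "\<forall>l < n * m. 0 \<le> t $ l"
  shows "\<forall>u < m. \<forall>v < n. uot_safe_region m n lam c D y (relaxed_region m n lam c t u v)"
  using uot_dual_feasible_subset_relaxed_region[OF assms(9)]
  unfolding uot_safe_region_def uot_dual_optimal_def by blast

end
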